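(* Let $R$ be a finite ring and let $r\in R$. (a) If $r=0$, then $\Gamma_R^r$ is not complete bipartite. (b) If $r\neq 0$, $|R|\geq 3$ and $|Z(R)|\geq 2$, then $\Gamma_R^r$ is not complete bipartite.
   Context: Rings are associative and not assumed to have a unity. $[x,y]:=xy-yx$. $Z(R)$ is the center of $R$. The $r$-noncommuting graph $\Gamma_R^r$ is the simple undirected graph with vertex set $R$ in which two distinct vertices $x,y$ are adjacent if and only if $[x,y]\neq r$ and $[x,y]\neq -r$. A graph is complete bipartite if its vertex set is a disjoint union of two nonempty sets $V_1,V_2$ such that two vertices are adjacent exactly when one is in $V_1$ and the other is in $V_2$. *)

theory Defs
  imports "Graph_Theory.Kuratowski"
begin

(* The class ring consists of the associative rings with no unity assumed; the zero ring is included. *)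

definition commutator :: "'a::ring \<Rightarrow> 'a \<Rightarrow> 'a" where
  "commutator x y = x * y - y * x"

definition center :: "'a::ring set" where
  "center = {z. \<forall>x. z * x = x * z}"

(* As usual in Graph_Theory, an undirected graph is a symmetric digraph; an edge between x and y
   is the pair of arcs (x, y) and (y, x). *)

definition noncommuting_graph :: "'a::ring \<Rightarrow> 'a pair_pre_digraph" where
  "noncommuting_graph r =
     \<lparr>pverts = UNIV,
      parcs = {(x, y). x \<noteq> y \<and> commutator x y \<noteq> r \<and> commutator x y \<noteq> - r}\<rparr>"

definition complete_bipartite :: "('a, 'b) pre_digraph \<Rightarrow> bool" where
  "complete_bipartite G \<longleftrightarrow> (\<exists>m n. m > 0 \<and> n > 0 \<and> complete_bipartite_digraph m n G)"

(* complete_bipartite_digraph also demands that its argument be a finite simple graph. The next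
   lemma shows that this holds for every noncommuting graph of a finite ring. *)

lemma pair_graph_noncommuting_graph:
  fixes r :: "'a::{ring,finite}"
  shows "pair_graph (noncommuting_graph r)"
proof
  have anti: "commutator y x = - commutator x y" for x y :: 'a
    by (simp add: commutator_def)
  have "(y, x) \<in> parcs (noncommuting_graph r)" if "(x, y) \<in> parcs (noncommuting_graph r)" for x y
    using that anti[of x y] by (auto simp: noncommuting_graph_def)
  then show "symmetric (with_proj (noncommuting_graph r))"
    by (auto simp: symmetric_def intro: symI)
qed (auto simp: noncommuting_graph_def)

lemma complete_bipartite_with_proj_iff:
  assumes "finite (pverts G)"
  shows "complete_bipartite (with_proj G) \<longleftrightarrow>
    (\<exists>V1 V2. pverts G = V1 \<union> V2 \<and> V1 \<inter> V2 = {} \<and> V1 \<noteq> {} \<and> V2 \<noteq> {} \<and>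
       parcs G = V1 \<times> V2 \<union> V2 \<times> V1)"
proof -
  have "complete_bipartite (with_proj G) \<longleftrightarrow>
    (\<exists>V1 V2. pverts G = V1 \<union> V2 \<and> V1 \<inter> V2 = {} \<and> card V1 > 0 \<and> card V2 > 0 \<and>
       parcs G = V1 \<times> V2 \<union> V2 \<times> V1)"
    unfolding complete_bipartite_def complete_bipartite_digraph_pair_def
    using assms by blast
  also have "\<dots> \<longleftrightarrow> (\<exists>V1 V2. pverts G = V1 \<union> V2 \<and> V1 \<inter> V2 = {} \<and> V1 \<noteq> {} \<and> V2 \<noteq> {} \<and>
       parcs G = V1 \<times> V2 \<union> V2 \<times> V1)"
  proof -
    have "finite V1 \<and> finite V2" if "pverts G = V1 \<union> V2" for V1 V2
      using assms that by simp
    then show ?thesis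
      unfolding card_gt_0_iff by blast
  qed
  finally show ?thesis .
qed

end

(* If r = 0, the vertex 0 is isolated, since it commutes with everything. If r is nonzero, every
   central element is adjacent to all other vertices, so two central elements and any third vertex
   form a triangle, which a bipartite graph cannot contain. *)

theory Submission
  imports Defs
begin

text \<open>Both sides are nonempty, so whichever side contains \<open>x\<close>, any vertex of the
  opposite side serves as \<open>y\<close>.\<close>

lemma complete_bipartite_ex_arc:
  assumes "complete_bipartite (with_proj G)" "finite (pverts G)" "x \<in> pverts G"
  shows "\<exists>y. (x, y) \<in> parcs G"
proof -
  obtain V1 V2 where "pverts G = V1 \<union> V2" "V1 \<noteq> {}" "V2 \<noteq> {}"
      "parcs G = V1 \<times> V2 \<union> V2 \<times> V1"
    using assms(1) unfolding complete_bipartite_with_proj_iff[OF assms(2)] by blast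
  then show ?thesis
    using assms(3) by auto
qed

text \<open>Each arc switches sides, so two consecutive arcs lead back to the side of
  \<open>x\<close>, and no arc joins two vertices of the same side.\<close>

lemma complete_bipartite_triangle_free:
  assumes "complete_bipartite (with_proj G)" "finite (pverts G)"
    and "(x, y) \<in> parcs G" "(y, z) \<in> parcs G"
  shows "(x, z) \<notin> parcs G"
proof -
  obtain V1 V2 where "V1 \<inter> V2 = {}" "parcs G = V1 \<times> V2 \<union> V2 \<times> V1"
    using assms(1) unfolding complete_bipartite_with_proj_iff[OF assms(2)] by blast
  then show ?thesis
    using assms(3,4) by auto
qed

lemma zero_isolated: "(0, y) \<notin> parcs (noncommuting_graph 0)"
  by (simp add: noncommuting_graph_def commutator_def)

text \<open>The commutator vanishes, whereas \<open>r\<close> and \<open>- r\<close> are both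
  nonzero. Only the source has to be central.\<close>

lemma central_adjacent:
  assumes "z \<in> center" "y \<noteq> z" "r \<noteq> 0"
  shows "(z, y) \<in> parcs (noncommuting_graph r)"
proof -
  have "commutator z y = 0"
    using assms(1) by (simp add: center_def commutator_def)
  then show ?thesis
    using assms(2,3) by (auto simp: noncommuting_graph_def)
qed

lemma not_complete_bipartite_zero:
  "\<not> complete_bipartite (with_proj (noncommuting_graph (0 :: 'a::{ring,finite})))"
  using complete_bipartite_ex_arc[of "noncommuting_graph (0 :: 'a)" 0] zero_isolated
  by (auto simp: noncommuting_graph_def)

lemma not_complete_bipartite_nonzero:
  fixes r :: "'a::{ring,finite}"
  assumes "r \<noteq> 0" "card (UNIV :: 'a set) \<ge> 3" "card (center :: 'a set) \<ge> 2"
  shows "\<not> complete_bipartite (with_proj (noncommuting_graph r))"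
proof
  assume bip: "complete_bipartite (with_proj (noncommuting_graph r))"
  obtain z1 z2 :: 'a where z: "z1 \<in> center" "z2 \<in> center" "z1 \<noteq> z2"
    \<comment> \<open>The bound is rewritten as the negation of
      \<open>card center \<le> Suc 0\<close>, which for a finite set says that any two elements
      coincide.\<close>
    using assms(3) by (auto simp: card_le_Suc0_iff_eq numeral_2_eq_2 Suc_le_eq not_le[symmetric])
  \<comment> \<open>The ring has at least three elements, so two of them cannot exhaust it; this
    yields the third vertex \<open>w\<close>.\<close>
  have "{z1, z2} \<noteq> UNIV"
  proof
    assume "{z1, z2} = UNIV"
    then have "card (UNIV :: 'a set) = 2"
      using z(3) card_2_iff by metis
    then show False
      using assms(2) by simp
  qed
  then obtain w where w: "w \<noteq> z1" "w \<noteq> z2"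
    by blast
  \<comment> \<open>All three arcs start at \<open>z1\<close> or \<open>z2\<close>, so
    \<open>w\<close> may be non-central.\<close>
  have "(z1, z2) \<in> parcs (noncommuting_graph r)" "(z2, w) \<in> parcs (noncommuting_graph r)"
    "(z1, w) \<in> parcs (noncommuting_graph r)"
    using z w assms(1) by (auto intro: central_adjacent)
  then show False
    using complete_bipartite_triangle_free[OF bip] by simp
qed

theorem proposition2p7:
  fixes r :: "'a::{ring,finite}"
  shows "(r = 0 \<longrightarrow> \<not> complete_bipartite (with_proj (noncommuting_graph r))) \<and>
    (r \<noteq> 0 \<and> card (UNIV :: 'a set) \<ge> 3 \<and> card (center :: 'a set) \<ge> 2 \<longrightarrow>
       \<not> complete_bipartite (with_proj (noncommuting_graph r)))"
  using not_complete_bipartite_zero not_complete_bipartite_nonzero by blast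

end
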